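(* Let $(A,\prec,\succ,\alpha)$ be a Hom-dendriform algebra. Define the linear map $\lhd\colon A\otimes A\to A$ by $$x\lhd y=x\prec y-y\succ x$$ for $x,y\in A$. Then $A_r=(A,\lhd,\alpha)$ is a right Hom-preLie algebra.
   Context: $\mathbb{K}$ is a fixed field of characteristic $0$; all maps are $\mathbb{K}$-linear. A Hom-dendriform algebra is $(A,\prec,\succ,\alpha)$ with $A$ a $\mathbb{K}$-module, linear maps $\prec,\succ\colon A\otimes A\to A$ and $\alpha\colon A\to A$ satisfying, for all $x,y,z\in A$: $(x\prec y)\prec\alpha(z)=\alpha(x)\prec(y\prec z+y\succ z)$; $(x\succ y)\prec\alpha(z)=\alpha(x)\succ(y\prec z)$; $(x\prec y+x\succ y)\succ\alpha(z)=\alpha(x)\succ(y\succ z)$. A right Hom-preLie algebra is a triple $(A,\mu,\alpha)$ with $A$ a $\mathbb{K}$-module, $\mu$ bilinear on $A$ and $\alpha\colon A\to A$ linear, satisfying $\mu(\alpha(x),\mu(y,z))-\mu(\alpha(x),\mu(z,y))=\mu(\mu(x,y),\alpha(z))-\mu(\mu(x,z),\alpha(y))$ for all $x,y,z\in A$. *)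

theory Defs
  imports Complex_Main
begin

text \<open>
  A linear map out of the tensor square of \<open>A\<close> is given by the corresponding bilinear map
  on \<open>A\<close>, in curried form. The constant \<open>bilinear\<close> of HOL-Analysis is restricted to real scalars.
\<close>

definition bilinear_on_vs ::
  "('k::field \<Rightarrow> 'a::ab_group_add \<Rightarrow> 'a) \<Rightarrow> ('a \<Rightarrow> 'a \<Rightarrow> 'a) \<Rightarrow> bool" where
  "bilinear_on_vs scale m \<longleftrightarrow>
     (\<forall>x. Vector_Spaces.linear scale scale (\<lambda>y. m x y)) \<and>
     (\<forall>y. Vector_Spaces.linear scale scale (\<lambda>x. m x y))"

locale hom_dendriform_algebra = vector_space scale
  for scale :: "'k::field_char_0 \<Rightarrow> 'a::ab_group_add \<Rightarrow> 'a" +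
  fixes prec :: "'a \<Rightarrow> 'a \<Rightarrow> 'a" (infixl \<open>\<prec>\<close> 70)
    and succ :: "'a \<Rightarrow> 'a \<Rightarrow> 'a" (infixl \<open>\<succ>\<close> 70)
    and \<alpha> :: "'a \<Rightarrow> 'a"
  assumes bilinear_prec: "bilinear_on_vs scale (\<prec>)"
    and bilinear_succ: "bilinear_on_vs scale (\<succ>)"
    and linear_twist: "Vector_Spaces.linear scale scale \<alpha>"
    and prec_prec: "(x \<prec> y) \<prec> \<alpha> z = \<alpha> x \<prec> (y \<prec> z + y \<succ> z)"
    and succ_prec: "(x \<succ> y) \<prec> \<alpha> z = \<alpha> x \<succ> (y \<prec> z)"
    and succ_succ: "(x \<prec> y + x \<succ> y) \<succ> \<alpha> z = \<alpha> x \<succ> (y \<succ> z)"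

locale right_hom_preLie_algebra = vector_space scale
  for scale :: "'k::field_char_0 \<Rightarrow> 'a::ab_group_add \<Rightarrow> 'a" +
  fixes \<mu> :: "'a \<Rightarrow> 'a \<Rightarrow> 'a"
    and \<alpha> :: "'a \<Rightarrow> 'a"
  assumes bilinear_mult: "bilinear_on_vs scale \<mu>"
    and linear_twist: "Vector_Spaces.linear scale scale \<alpha>"
    and right_hom_preLie:
      "\<mu> (\<alpha> x) (\<mu> y z) - \<mu> (\<alpha> x) (\<mu> z y) = \<mu> (\<mu> x y) (\<alpha> z) - \<mu> (\<mu> x z) (\<alpha> y)"

end

theory Submission
  imports Defs
begin

text \<open>Write \<open>y * z = y \<prec> z + y \<succ> z\<close>. The new product has the same
  commutator as \<open>*\<close>, so the left side of the preLie identity involves only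
  \<open>y * z - z * y\<close>. \<open>prec_prec\<close> and \<open>succ_succ\<close> evaluate
  \<open>*\<close> inside \<open>\<prec>\<close> and \<open>\<succ>\<close>, and what they yield is
  exactly the unmixed part of the right side. The mixed terms there cancel in pairs by
  \<open>succ_prec\<close>.\<close>

lemma bilinear_on_vs_add_left:
  "bilinear_on_vs scale m \<Longrightarrow> m (x + y) z = m x z + m y z"
  by (simp add: bilinear_on_vs_def Vector_Spaces.linear_iff)

lemma bilinear_on_vs_add_right:
  "bilinear_on_vs scale m \<Longrightarrow> m x (y + z) = m x y + m x z"
  by (simp add: bilinear_on_vs_def Vector_Spaces.linear_iff)

text \<open>Additivity applied to \<open>x = (x - y) + y\<close> suffices; scalars do not
  enter.\<close>

lemma bilinear_on_vs_diff_left: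
  "bilinear_on_vs scale m \<Longrightarrow> m (x - y) z = m x z - m y z"
  using bilinear_on_vs_add_left[of scale m "x - y" y z] by (simp add: eq_diff_eq)

lemma bilinear_on_vs_diff_right:
  "bilinear_on_vs scale m \<Longrightarrow> m x (y - z) = m x y - m x z"
  using bilinear_on_vs_add_right[of scale m x "y - z" z] by (simp add: eq_diff_eq)

lemma bilinear_on_vs_flip:
  "bilinear_on_vs scale m \<Longrightarrow> bilinear_on_vs scale (\<lambda>x y. m y x)"
  by (simp add: bilinear_on_vs_def)

lemma bilinear_on_vs_diff:
  assumes "bilinear_on_vs scale m" and "bilinear_on_vs scale n"
  shows "bilinear_on_vs scale (\<lambda>x y. m x y - n x y)"
proof -
  \<comment> \<open>Linearity of a map includes the vector space axioms for \<open>scale\<close>,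
    which gives access to \<open>linear_compose_sub\<close>.\<close>
  have "vector_space scale"
    using assms(1) by (simp add: bilinear_on_vs_def Vector_Spaces.linear_iff)
  then interpret vector_space_pair scale scale
    by (simp add: vector_space_pair_def)
  show ?thesis
    using assms by (simp add: bilinear_on_vs_def linear_compose_sub)
qed

theorem theorem6p8:
  fixes scale :: "'k::field_char_0 \<Rightarrow> 'a::ab_group_add \<Rightarrow> 'a"
    and prec :: "'a \<Rightarrow> 'a \<Rightarrow> 'a" (infixl \<open>\<prec>\<close> 70)
    and succ :: "'a \<Rightarrow> 'a \<Rightarrow> 'a" (infixl \<open>\<succ>\<close> 70)
    and \<alpha> :: "'a \<Rightarrow> 'a"
  assumes "hom_dendriform_algebra scale (\<prec>) (\<succ>) \<alpha>"
  shows "right_hom_preLie_algebra scale (\<lambda>x y. x \<prec> y - y \<succ> x) \<alpha>"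
proof -
  interpret hom_dendriform_algebra scale prec succ \<alpha>
    by (fact assms)
  note additive =
    bilinear_on_vs_add_left[OF bilinear_prec] bilinear_on_vs_add_right[OF bilinear_prec]
    bilinear_on_vs_diff_left[OF bilinear_prec] bilinear_on_vs_diff_right[OF bilinear_prec]
    bilinear_on_vs_add_left[OF bilinear_succ] bilinear_on_vs_add_right[OF bilinear_succ]
    bilinear_on_vs_diff_left[OF bilinear_succ] bilinear_on_vs_diff_right[OF bilinear_succ]
  show ?thesis
  proof (intro right_hom_preLie_algebra.intro right_hom_preLie_algebra_axioms.intro)
    show "vector_space scale"
      by (fact vector_space_axioms)
    show "bilinear_on_vs scale (\<lambda>x y. x \<prec> y - y \<succ> x)"
      by (fact bilinear_on_vs_diff[OF bilinear_prec bilinear_on_vs_flip[OF bilinear_succ]])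
    show "Vector_Spaces.linear scale scale \<alpha>"
      by (fact linear_twist)
    show "\<alpha> x \<prec> (y \<prec> z - z \<succ> y) - (y \<prec> z - z \<succ> y) \<succ> \<alpha> x
        - (\<alpha> x \<prec> (z \<prec> y - y \<succ> z) - (z \<prec> y - y \<succ> z) \<succ> \<alpha> x)
      = (x \<prec> y - y \<succ> x) \<prec> \<alpha> z - \<alpha> z \<succ> (x \<prec> y - y \<succ> x)
        - ((x \<prec> z - z \<succ> x) \<prec> \<alpha> y - \<alpha> y \<succ> (x \<prec> z - z \<succ> x))" for x y z
    proof -
      \<comment> \<open>After expansion the right arguments differ by \<open>y * z - z * y\<close>,
        so \<open>prec_prec\<close> applies to each half.\<close>
      have "\<alpha> x \<prec> (y \<prec> z - z \<succ> y) - \<alpha> x \<prec> (z \<prec> y - y \<succ> z)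
          = (x \<prec> y) \<prec> \<alpha> z - (x \<prec> z) \<prec> \<alpha> y"
        by (simp only: prec_prec additive) simp
      \<comment> \<open>The same commutator, now as left argument. \<open>succ_succ\<close> is
        reversed so that both sides expand into terms
        \<open>(_ \<succ> _) \<succ> \<alpha> x\<close> and
        \<open>(_ \<prec> _) \<succ> \<alpha> x\<close>.\<close>
      moreover have "(y \<prec> z - z \<succ> y) \<succ> \<alpha> x - (z \<prec> y - y \<succ> z) \<succ> \<alpha> x
          = \<alpha> y \<succ> (z \<succ> x) - \<alpha> z \<succ> (y \<succ> x)"
        by (simp only: succ_succ[symmetric] additive) simp
      ultimately show ?thesis
        \<comment> \<open>\<open>succ_prec\<close> turns
          \<open>(y \<succ> x) \<prec> \<alpha> z\<close> into
          \<open>\<alpha> y \<succ> (x \<prec> z)\<close>, which cancels against the term with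
          \<open>y\<close> and \<open>z\<close> exchanged.\<close>
        by (simp only: additive succ_prec) (simp add: algebra_simps)
    qed
  qed
qed

end
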